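(* For every convex compact domain $\Omega\subset\mathbb{R}^2$ one has $\dfrac{K_1(\Omega)}{k_1(\Omega)}\le 4$. Consequently $r_1:=\inf_\Omega \dfrac{K_1(\Omega)}{k_1(\Omega)}\le 4$, where the infimum is over all convex compact domains $\Omega\subset\mathbb{R}^2$.
   Context: A convex compact domain is a compact convex set $\Omega\subset\mathbb{R}^2$ with nonempty interior. $\mathcal{U}_\Omega$ denotes the class of continuous concave functions $u:\Omega\to\mathbb{R}$ with $u|_{\partial\Omega}=0$ whose gradient $\nabla u=(u_x,u_y)$ is uniformly bounded over all interior points of $\Omega$ at which it is defined (it is defined almost everywhere). $\|f\|_1=\int_\Omega |f|\,dx\,dy$, and $$K_1(\Omega)=\sup_{u\in\mathcal{U}_\Omega,\ u\ne0}\frac{\|u_x\|_1}{\|u_y\|_1},\qquad k_1(\Omega)=\inf_{u\in\mathcal{U}_\Omega,\ u\ne0}\frac{\|u_x\|_1}{\|u_y\|_1}.$$ *)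

theory Defs
  imports "HOL-Analysis.Analysis"
begin

definition convex_compact_domain :: "(real \<times> real) set \<Rightarrow> bool" where
  "convex_compact_domain \<Omega> \<longleftrightarrow> compact \<Omega> \<and> convex \<Omega> \<and> interior \<Omega> \<noteq> {}"

text \<open>
  Functions on \<open>\<Omega>\<close> are total functions on the plane of which only the restriction to \<open>\<Omega>\<close>
  is constrained. The derivatives below depend on that restriction alone at interior points
  of \<open>\<Omega>\<close>; the boundary of a convex set is a null set, so the values there (and the
  arbitrary values of \<^const>\<open>deriv\<close> at the remaining null set of points of
  non-differentiability) do not affect the integrals.
\<close>

definition partial_x :: "(real \<times> real \<Rightarrow> real) \<Rightarrow> real \<times> real \<Rightarrow> real" where
  "partial_x u p = deriv (\<lambda>t. u (t, snd p)) (fst p)"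

definition partial_y :: "(real \<times> real \<Rightarrow> real) \<Rightarrow> real \<times> real \<Rightarrow> real" where
  "partial_y u p = deriv (\<lambda>t. u (fst p, t)) (snd p)"

definition gradient_defined_at :: "(real \<times> real \<Rightarrow> real) \<Rightarrow> real \<times> real \<Rightarrow> bool" where
  "gradient_defined_at u p \<longleftrightarrow>
     (\<lambda>t. u (t, snd p)) field_differentiable at (fst p) \<and>
     (\<lambda>t. u (fst p, t)) field_differentiable at (snd p)"

definition U_class :: "(real \<times> real) set \<Rightarrow> (real \<times> real \<Rightarrow> real) set" where
  "U_class \<Omega> = {u. continuous_on \<Omega> u \<and> concave_on \<Omega> u \<and> (\<forall>p\<in>frontier \<Omega>. u p = 0) \<and>
     (\<exists>B. \<forall>p\<in>interior \<Omega>. gradient_defined_at u p \<longrightarrow>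
        norm (partial_x u p, partial_y u p) \<le> B)}"

definition U_class_nonzero :: "(real \<times> real) set \<Rightarrow> (real \<times> real \<Rightarrow> real) set" where
  "U_class_nonzero \<Omega> = {u \<in> U_class \<Omega>. \<exists>p\<in>\<Omega>. u p \<noteq> 0}"

definition L1_norm_on :: "(real \<times> real) set \<Rightarrow> (real \<times> real \<Rightarrow> real) \<Rightarrow> ennreal" where
  "L1_norm_on \<Omega> f = (\<integral>\<^sup>+ p\<in>\<Omega>. ennreal \<bar>f p\<bar> \<partial>lborel)"

text \<open>
  Values in \<^typ>\<open>ennreal\<close> keep suprema, infima and integrals free of side conditions.
\<close>

definition K\<^sub>1 :: "(real \<times> real) set \<Rightarrow> ennreal" where
  "K\<^sub>1 \<Omega> = (SUP u\<in>U_class_nonzero \<Omega>. L1_norm_on \<Omega> (partial_x u) / L1_norm_on \<Omega> (partial_y u))"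

definition k\<^sub>1 :: "(real \<times> real) set \<Rightarrow> ennreal" where
  "k\<^sub>1 \<Omega> = (INF u\<in>U_class_nonzero \<Omega>. L1_norm_on \<Omega> (partial_x u) / L1_norm_on \<Omega> (partial_y u))"

definition r\<^sub>1 :: ennreal where
  "r\<^sub>1 = (INF \<Omega>\<in>{\<Omega>. convex_compact_domain \<Omega>}. K\<^sub>1 \<Omega> / k\<^sub>1 \<Omega>)"

end

theory Submission imports Defs begin

text \<open>
  Let \<open>u\<close> be concave on \<open>\<Omega>\<close>, zero on the frontier, not identically zero, and let \<open>m > 0\<close> be its
  maximum. On each horizontal line \<open>u\<close> is a concave function that rises from \<open>0\<close> to a maximum \<open>M(y)\<close>
  and returns to \<open>0\<close>, so that the integral of \<open>\<bar>u\<^sub>x\<bar>\<close> along the line is \<open>2 M(y)\<close>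
  (\<open>nn_integral_abs_deriv_concave\<close>, \<open>slice_integral\<close>). Hence, by Tonelli, the norm of \<open>u\<^sub>x\<close> is twice
  the integral of \<open>M\<close> over the projection \<open>[c, d]\<close> of \<open>\<Omega>\<close> to the vertical axis.

  Clearly \<open>M \<le> m\<close>. Conversely, joining a maximum point of \<open>u\<close> to a lowest and to a highest point of
  \<open>\<Omega>\<close> and using concavity along these two segments, \<open>M\<close> dominates the tent function of height \<open>m\<close> over
  \<open>[c, d]\<close>, whose integral is \<open>m (d - c) / 2\<close>. With \<open>h = d - c\<close> the height of \<open>\<Omega>\<close> this says
  that the norm of \<open>u\<^sub>x\<close> lies between \<open>m h\<close> and \<open>2 m h\<close> (\<open>L1_norm_partial_x_bounds\<close>).

  Exchanging the coordinates, the norm of \<open>u\<^sub>y\<close> lies between \<open>m w\<close> and \<open>2 m w\<close>, where \<open>w\<close> is the width of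
  \<open>\<Omega>\<close> and \<open>m\<close> is the same number. The quotient of the norms therefore lies between \<open>h / (2 w)\<close> and
  \<open>2 h / w\<close> for every \<open>u\<close> (\<open>U_class_ratio_bounds\<close>), and these two bounds differ by the factor \<open>4\<close>.
  The supremum and the infimum range over a nonempty set because the distance to the complement of
  \<open>\<Omega>\<close> belongs to the class (\<open>U_class_nonzero_nonempty\<close>).

  Two analytic points need care. A concave function of one variable may fail to be differentiable at
  countably many points, so a fundamental theorem of calculus with a countable exceptional set is
  proved first. And Tonelli requires \<open>u\<^sub>x\<close> to be Borel measurable; this holds on the interior since
  there \<^const>\<open>deriv\<close> is expressed by the two one-sided derivatives, which are limits of difference
  quotients (\<open>borel_measurable_partial_x\<close>).
\<close>

section \<open>The fundamental theorem of calculus with countably many exceptional points\<close>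

text \<open>
  A Henstock sum telescopes in both \<open>f\<close> and \<open>T\<close>, so a local error that is small relative to the
  increment of a single monotone function adds up to a small global error. Allowing jumps in \<open>T\<close> is
  what makes room for exceptional points in the next lemma.
\<close>

lemma has_integral_if_increments_dominated:
  fixes f g T :: "real \<Rightarrow> real"
  assumes ab: "a \<le> b" and T: "mono T"
    and loc: "\<And>e x. 0 < e \<Longrightarrow> x \<in> {a..b} \<Longrightarrow> \<exists>d>0. \<forall>y\<in>{a..b}. \<bar>y - x\<bar> < d \<longrightarrow>
                \<bar>f y - f x - (y - x) * g x\<bar> \<le> e * \<bar>T y - T x\<bar>"
  shows "(g has_integral (f b - f a)) {a..b}"
  unfolding has_integral_real
proof (intro allI impI)
  fix e :: real
  assume "0 < e"
  have Tab: "0 \<le> T b - T a"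
    using monoD[OF T ab] by simp
  define e' where "e' = e / (T b - T a + 1)"
  have "0 < e'"
    using \<open>0 < e\<close> Tab by (simp add: e'_def)
  have "\<forall>x. \<exists>d>0. x \<in> {a..b} \<longrightarrow> (\<forall>y\<in>{a..b}. \<bar>y - x\<bar> < d \<longrightarrow>
                \<bar>f y - f x - (y - x) * g x\<bar> \<le> e' * \<bar>T y - T x\<bar>)"
    using loc[OF \<open>0 < e'\<close>] zero_less_one by blast
  then obtain d where d: "\<And>x. 0 < d x"
    and dle: "\<And>x y. x \<in> {a..b} \<Longrightarrow> y \<in> {a..b} \<Longrightarrow> \<bar>y - x\<bar> < d x \<Longrightarrow>
                \<bar>f y - f x - (y - x) * g x\<bar> \<le> e' * \<bar>T y - T x\<bar>"
    by metis
  show "\<exists>\<gamma>. gauge \<gamma> \<and> (\<forall>p. p tagged_division_of {a..b} \<and> \<gamma> fine p \<longrightarrow>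
          norm ((\<Sum>(x,k)\<in>p. measure lborel k *\<^sub>R g x) - (f b - f a)) < e)"
  proof (intro exI conjI allI impI)
    show "gauge (\<lambda>x. ball x (d x))"
      using d by (rule gauge_ball_dependent[rule_format])
    fix p
    assume p: "p tagged_division_of {a..b} \<and> (\<lambda>x. ball x (d x)) fine p"
    then have ptag: "p tagged_division_of {a..b}" and fine: "(\<lambda>x. ball x (d x)) fine p"
      by auto
    have step: "\<bar>measure lborel K * g x - (f (Sup K) - f (Inf K))\<bar> \<le> e' * (T (Sup K) - T (Inf K))"
      if xKp: "(x, K) \<in> p" for x K
    proof -
      have xK: "x \<in> K" "K \<subseteq> {a..b}" "K \<subseteq> ball x (d x)"
        using ptag fine that by (auto simp: fine_def)
      obtain u v where K: "K = {u..v}"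
        using tagged_division_ofD(4)[OF ptag xKp] by (metis box_real(2))
      have uv: "u \<le> x" "x \<le> v"
        using xK(1) K by auto
      then have "u \<in> K" "v \<in> K"
        using K by auto
      then have u: "u \<in> {a..b}" "\<bar>u - x\<bar> < d x" and v: "v \<in> {a..b}" "\<bar>v - x\<bar> < d x"
        and x: "x \<in> {a..b}"
        using xK by (auto simp only: subset_iff mem_ball dist_real_def abs_minus_commute)
      have "\<bar>(v - u) * g x - (f v - f u)\<bar> \<le> \<bar>f v - f x - (v - x) * g x\<bar> + \<bar>f u - f x - (u - x) * g x\<bar>"
        by (auto simp: algebra_simps)
      also have "\<dots> \<le> e' * \<bar>T v - T x\<bar> + e' * \<bar>T u - T x\<bar>"
        by (intro add_mono dle x u v)
      also have "\<dots> = e' * (T v - T u)"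
        using monoD[OF T uv(1)] monoD[OF T uv(2)] by (simp add: algebra_simps)
      finally show ?thesis
        using K uv by simp
    qed
    have eq: "(\<Sum>(x,K)\<in>p. f (Sup K) - f (Inf K)) = f b - f a"
      "(\<Sum>(x,K)\<in>p. T (Sup K) - T (Inf K)) = T b - T a"
      using additive_tagged_division_1[OF ab ptag] by auto
    have "norm ((\<Sum>(x,K)\<in>p. measure lborel K *\<^sub>R g x) - (f b - f a))
        = \<bar>\<Sum>(x,K)\<in>p. measure lborel K * g x - (f (Sup K) - f (Inf K))\<bar>"
      unfolding eq(1)[symmetric] by (simp add: sum_subtractf[symmetric] case_prod_unfold)
    also have "\<dots> \<le> (\<Sum>(x,K)\<in>p. e' * (T (Sup K) - T (Inf K)))"
      by (rule order_trans[OF sum_abs sum_mono]) (use step in auto)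
    also have "\<dots> = e' * (T b - T a)"
      unfolding eq(2)[symmetric] by (simp add: sum_distrib_left case_prod_unfold)
    also have "\<dots> < e"
      using \<open>0 < e\<close> Tab by (simp add: e'_def field_simps)
    finally show "norm ((\<Sum>(x,K)\<in>p. measure lborel K *\<^sub>R g x) - (f b - f a)) < e" .
  qed
qed

text \<open>
  Here \<open>T\<close> is the identity plus a monotone function that jumps by at least \<open>(1 / 2) ^ n\<close> on either side
  of the \<open>n\<close>-th exceptional point. Near such a point the jump absorbs the increment of \<open>f\<close>, which is small
  by continuity alone; elsewhere the identity part absorbs the error of the linear approximation.
\<close>
lemma fundamental_theorem_of_calculus_countable:
  fixes f f' :: "real \<Rightarrow> real"
  assumes S: "countable S" and ab: "a \<le> b" and cont: "continuous_on {a..b} f"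
    and deriv: "\<And>x. x \<in> {a<..<b} - S \<Longrightarrow> (f has_real_derivative f' x) (at x)"
  shows "(f' has_integral (f b - f a)) {a..b}"
proof -
  \<comment> \<open>The end points count as exceptional, since a two-sided derivative is only given inside.\<close>
  define S' where "S' = insert a (insert b S)"
  define s where "s = from_nat_into S'"
  have S': "countable S'" "S' \<noteq> {}"
    using S by (auto simp: S'_def)
  define c where "c t n = (1 / 2) ^ n * (of_bool (s n \<le> t) + of_bool (s n < t) :: real)" for t n
  define T where "T t = t + (\<Sum>n. c t n)" for t
  define g where "g x = (if x \<in> S' then 0 else f' x)" for x
  have sum: "summable (c t)" for t
  proof (rule summable_comparison_test')
    show "summable (\<lambda>n. 2 * (1 / 2 :: real) ^ n)"
      by (intro summable_mult summable_geometric) simp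
    show "norm (c t n) \<le> 2 * (1 / 2) ^ n" for n
      by (simp add: c_def of_bool_def)
  qed
  have c_mono: "c x n \<le> c y n" if "x \<le> y" for x y n
    using that by (auto simp: c_def of_bool_def)
  have T_mono: "y - x + (c y n - c x n) \<le> T y - T x" if "x \<le> y" for x y n
  proof -
    have "c y n - c x n = (\<Sum>i\<in>{n}. c y i - c x i)" by simp
    also have "\<dots> \<le> (\<Sum>i. c y i - c x i)"
      using that by (intro sum_le_suminf summable_diff sum) (auto simp: c_mono)
    also have "\<dots> = (\<Sum>i. c y i) - (\<Sum>i. c x i)"
      using suminf_diff[OF sum sum] by metis
    finally show ?thesis by (simp add: T_def)
  qed
  have "mono T"
  proof (rule monoI)
    fix x y :: real assume "x \<le> y"
    then show "T x \<le> T y"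
      using T_mono[of x y 0] c_mono[of x y 0] by linarith
  qed
  have len: "\<bar>y - x\<bar> \<le> \<bar>T y - T x\<bar>" for x y
    using T_mono[of x y 0] T_mono[of y x 0] c_mono[of x y 0] c_mono[of y x 0] by linarith
  have jump: "(1 / 2) ^ n \<le> \<bar>T y - T (s n)\<bar>" if "y \<noteq> s n" for y n
  proof -
    have "c (s n) n + (1 / 2) ^ n \<le> c y n" if "s n < y"
      using that by (simp add: c_def)
    moreover have "c y n + (1 / 2) ^ n \<le> c (s n) n" if "y < s n"
      using that by (simp add: c_def)
    ultimately show ?thesis
      using T_mono[of y "s n" n] T_mono[of "s n" y n] that by linarith
  qed
  have "(g has_integral (f b - f a)) {a..b}"
  proof (rule has_integral_if_increments_dominated[OF ab \<open>mono T\<close>])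
    fix e x :: real
    assume "0 < e" and x: "x \<in> {a..b}"
    show "\<exists>d>0. \<forall>y\<in>{a..b}. \<bar>y - x\<bar> < d \<longrightarrow> \<bar>f y - f x - (y - x) * g x\<bar> \<le> e * \<bar>T y - T x\<bar>"
    proof (cases "x \<in> S'")
      case True
      then obtain n where n: "x = s n"
        using from_nat_into_surj[OF S'(1)] by (metis s_def)
      have "0 < e * (1 / 2) ^ n" using \<open>0 < e\<close> by simp
      then obtain d where "d > 0" and d: "\<And>y. y \<in> {a..b} \<Longrightarrow> \<bar>y - x\<bar> < d \<Longrightarrow> \<bar>f y - f x\<bar> < e * (1 / 2) ^ n"
        using cont x unfolding continuous_on_iff dist_real_def by blast
      have "\<bar>f y - f x\<bar> \<le> e * \<bar>T y - T x\<bar>" if "y \<in> {a..b}" "\<bar>y - x\<bar> < d" for y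
      proof (cases "y = x")
        case False
        then have "e * (1 / 2) ^ n \<le> e * \<bar>T y - T x\<bar>"
          using jump[of y n] n \<open>0 < e\<close> by (intro mult_left_mono) auto
        then show ?thesis
          using d[OF that] by linarith
      qed simp
      then show ?thesis
        using \<open>d > 0\<close> True by (auto simp: g_def)
    next
      case False
      then have "(f has_real_derivative f' x) (at x)"
        using x by (intro deriv) (auto simp: S'_def)
      then have "(f has_derivative (\<lambda>h. f' x * h)) (at x)"
        by (simp add: has_field_derivative_def)
      then obtain d where "d > 0" and d: "\<And>y. \<bar>y - x\<bar> < d \<Longrightarrow> \<bar>f y - f x - f' x * (y - x)\<bar> \<le> e * \<bar>y - x\<bar>"
        using \<open>0 < e\<close> unfolding has_derivative_at_alt real_norm_def by blast
      have "\<bar>f y - f x - (y - x) * g x\<bar> \<le> e * \<bar>T y - T x\<bar>" if "\<bar>y - x\<bar> < d" for y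
        using d[OF that] order_trans[OF _ mult_left_mono[OF len[of y x], of e]] \<open>0 < e\<close> False
        by (simp add: g_def mult.commute)
      then show ?thesis
        using \<open>d > 0\<close> by blast
    qed
  qed
  moreover have "negligible S'"
    using countable_imp_null_set_lborel[OF S'(1)]
    by (simp add: negligible_iff_null_sets null_sets_completionI)
  ultimately show ?thesis
    by (rule has_integral_spike[rotated 2]) (auto simp: g_def)
qed


section \<open>Concave functions of one variable\<close>

text \<open>
  The one-sided derivatives are taken along the increments \<open>1 / (n + 1)\<close> only, so that they depend
  measurably on parameters. For a concave function they agree with the true one-sided limits.
\<close>
definition right_deriv :: "(real \<Rightarrow> real) \<Rightarrow> real \<Rightarrow> real" where
  "right_deriv f x = lim (\<lambda>n. (f (x + 1 / real (Suc n)) - f x) / (1 / real (Suc n)))"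

definition left_deriv :: "(real \<Rightarrow> real) \<Rightarrow> real \<Rightarrow> real" where
  "left_deriv f x = lim (\<lambda>n. (f (x + - 1 / real (Suc n)) - f x) / (- 1 / real (Suc n)))"

lemma concave_on_slope_antimono:
  fixes f :: "real \<Rightarrow> real"
  assumes f: "concave_on S f" and S: "x \<in> S" "x + h \<in> S" "x + k \<in> S"
    and hk: "h < k" "h \<noteq> 0" "k \<noteq> 0"
  shows "(f (x + k) - f x) / k \<le> (f (x + h) - f x) / h"
proof -
  have c: "convex_on S (\<lambda>x. - f x)" using f by (simp add: concave_on_def)
  consider "0 < h" | "h < 0" "0 < k" | "k < 0" using hk by linarith
  then show ?thesis
  proof cases
    case 1
    then show ?thesis
      using convex_on_slope_le(1)[OF c S(1) S(3), of "x + h"] hk by (simp add: diff_divide_distrib)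
  next
    case 2
    then show ?thesis
      using order_trans[OF convex_on_slope_le[OF c S(2) S(3), of x]] hk
      by (simp add: diff_divide_distrib)
  next
    case 3
    then show ?thesis
      using convex_on_slope_le(2)[OF c S(2) S(1), of "x + k"] hk by (simp add: diff_divide_distrib)
  qed
qed

text \<open>
  The slope of the chord from \<open>x\<close> to \<open>x + h\<close> decreases in \<open>h\<close>, so the one-sided limits at \<open>h = 0\<close> exist
  as a supremum over \<open>h > 0\<close> and an infimum over \<open>h < 0\<close>.
\<close>
lemma concave_on_one_sided_derivs:
  fixes f :: "real \<Rightarrow> real"
  assumes f: "concave_on S f" and "open S" "x \<in> S"
  shows "((\<lambda>h. (f (x + h) - f x) / h) \<longlongrightarrow> right_deriv f x) (at_right 0)"
    and "((\<lambda>h. (f (x + h) - f x) / h) \<longlongrightarrow> left_deriv f x) (at_left 0)"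
    and "right_deriv f x \<le> left_deriv f x"
    and "\<And>y. y \<in> S \<Longrightarrow> x < y \<Longrightarrow> f y \<le> f x + right_deriv f x * (y - x)"
    and "\<And>y. y \<in> S \<Longrightarrow> y < x \<Longrightarrow> f y \<le> f x + left_deriv f x * (y - x)"
proof -
  obtain e where "e > 0" and e: "ball x e \<subseteq> S"
    using assms openE by blast
  define s where "s = (\<lambda>h. (f (x + h) - f x) / h)"
  define P where "P = {h. 0 < h \<and> x + h \<in> S}"
  define N where "N = {h. h < 0 \<and> x + h \<in> S}"
  have inS: "x + h \<in> S" if "\<bar>h\<bar> < e" for h
    using e that by (auto simp: dist_real_def subset_iff)
  have anti: "s k \<le> s h" if "h < k" "h \<in> P \<union> N" "k \<in> P \<union> N" for h k
    using concave_on_slope_antimono[OF f \<open>x \<in> S\<close>, of h k] that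
    by (auto simp: s_def P_def N_def)
  have PN: "e / 2 \<in> P" "- e / 2 \<in> N"
    using inS[of "e / 2"] inS[of "- e / 2"] \<open>e > 0\<close> by (auto simp: P_def N_def)
  have cross: "s k \<le> s h" if "k \<in> P" "h \<in> N" for h k
    using anti[of h k] that by (auto simp: P_def N_def)
  define R where "R = Sup (s ` P)"
  define L where "L = Inf (s ` N)"
  have bdd: "bdd_above (s ` P)" "bdd_below (s ` N)"
    using cross PN by (auto simp: bdd_above_def bdd_below_def)
  have sR: "s h \<le> R" if "h \<in> P" for h
    unfolding R_def using that bdd by (auto intro: cSup_upper)
  have sL: "L \<le> s h" if "h \<in> N" for h
    unfolding L_def using that bdd by (auto intro: cInf_lower)
  have RL: "R \<le> L"
    unfolding L_def R_def using PN cross by (intro cSup_least cInf_greatest) auto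
  have evP: "eventually (\<lambda>h. h \<in> P \<and> h < b) (at_right 0)" if "b > 0" for b
    using inS that \<open>e > 0\<close> unfolding eventually_at_right_field P_def
    by (intro exI[of _ "min b e"]) auto
  have evN: "eventually (\<lambda>h. h \<in> N \<and> b < h) (at_left 0)" if "b < 0" for b
    using inS that \<open>e > 0\<close> unfolding eventually_at_left_field N_def
    by (intro exI[of _ "max b (- e)"]) auto
  have limR: "(s \<longlongrightarrow> R) (at_right 0)"
  proof (rule order_tendstoI)
    fix a assume "a < R"
    then obtain k where k: "k \<in> P" "a < s k"
      unfolding R_def using less_cSupE[of a "s ` P"] PN by auto
    show "eventually (\<lambda>h. a < s h) (at_right 0)"
    proof (rule eventually_mono[OF evP[of k]])
      show "0 < k" using k by (simp add: P_def)
      show "a < s h" if "h \<in> P \<and> h < k" for h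
        using anti[of h k] k that by auto
    qed
  next
    fix a assume "R < a"
    then show "eventually (\<lambda>h. s h < a) (at_right 0)"
      using evP[OF zero_less_one] by (auto elim!: eventually_mono dest: sR)
  qed
  have limL: "(s \<longlongrightarrow> L) (at_left 0)"
  proof (rule order_tendstoI)
    fix a assume "L < a"
    then obtain k where k: "k \<in> N" "s k < a"
      unfolding L_def using cInf_lessD[of "s ` N" a] PN by auto
    show "eventually (\<lambda>h. s h < a) (at_left 0)"
    proof (rule eventually_mono[OF evN[of k]])
      show "k < 0" using k by (simp add: N_def)
      show "s h < a" if "h \<in> N \<and> k < h" for h
        using anti[of k h] k that by auto
    qed
  next
    fix a assume "a < L"
    then show "eventually (\<lambda>h. a < s h) (at_left 0)"
      using evN[of "- 1"] by (auto elim!: eventually_mono dest: sL)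
  qed
  have "filterlim (\<lambda>n. 1 / real (Suc n)) (at_right 0) sequentially"
    using LIMSEQ_inverse_real_of_nat
    by (auto simp: filterlim_at divide_inverse)
  from filterlim_compose[OF limR this] have R: "right_deriv f x = R"
    unfolding right_deriv_def s_def by (rule limI)
  have "filterlim (\<lambda>n. - 1 / real (Suc n)) (at_left 0) sequentially"
    using tendsto_minus[OF LIMSEQ_inverse_real_of_nat]
    by (auto simp: filterlim_at divide_inverse)
  from filterlim_compose[OF limL this] have L: "left_deriv f x = L"
    unfolding left_deriv_def s_def by (rule limI)
  show "((\<lambda>h. (f (x + h) - f x) / h) \<longlongrightarrow> right_deriv f x) (at_right 0)"
    "((\<lambda>h. (f (x + h) - f x) / h) \<longlongrightarrow> left_deriv f x) (at_left 0)"
    "right_deriv f x \<le> left_deriv f x"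
    using limR limL RL R L by (simp_all add: s_def)
  show "f y \<le> f x + right_deriv f x * (y - x)" if "y \<in> S" "x < y" for y
    using sR[of "y - x"] that by (simp add: P_def s_def R divide_simps)
  show "f y \<le> f x + left_deriv f x * (y - x)" if "y \<in> S" "y < x" for y
    using sL[of "y - x"] that by (simp add: N_def s_def L divide_simps)
qed

lemma concave_on_DERIV_iff:
  fixes f :: "real \<Rightarrow> real"
  assumes "concave_on S f" "open S" "x \<in> S"
  shows "DERIV f x :> D \<longleftrightarrow> right_deriv f x = D \<and> left_deriv f x = D"
proof -
  note lim = concave_on_one_sided_derivs(1,2)[OF assms]
  have "right_deriv f x = D \<and> left_deriv f x = D" if "DERIV f x :> D"
    using that lim unfolding DERIV_def filterlim_at_split
    by (auto intro: tendsto_unique[OF trivial_limit_at_right_real lim(1)]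
        tendsto_unique[OF trivial_limit_at_left_real lim(2)])
  moreover have "DERIV f x :> D" if "right_deriv f x = D" "left_deriv f x = D"
    using that lim unfolding DERIV_def filterlim_at_split by simp
  ultimately show ?thesis
    by blast
qed

text \<open>
  By its definition \<^const>\<open>deriv\<close> takes one and the same default value at every point of
  non-differentiability. Together with the formula below this makes it a measurable function of the
  one-sided derivatives.
\<close>
lemma deriv_concave_on:
  fixes f :: "real \<Rightarrow> real"
  assumes "concave_on S f" "open S" "x \<in> S"
  shows "deriv f x = (if right_deriv f x = left_deriv f x then right_deriv f x else (SOME D. False))"
proof (cases "right_deriv f x = left_deriv f x")
  case True
  then have "DERIV f x :> right_deriv f x"
    by (simp add: concave_on_DERIV_iff[OF assms])
  then show ?thesis
    using True by (simp add: DERIV_imp_deriv)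
next
  case False
  then have "(\<lambda>D. DERIV f x :> D) = (\<lambda>D. False)"
    by (auto simp: concave_on_DERIV_iff[OF assms])
  then show ?thesis
    using False by (simp add: deriv_def)
qed

text \<open>
  At a corner the right derivative is smaller than the left one. As the derivatives decrease, the open
  intervals between the two at different corners are disjoint, and each contains a rational number.
\<close>
lemma countable_not_differentiable_concave_on:
  fixes f :: "real \<Rightarrow> real"
  assumes f: "concave_on S f" and S: "open S"
  shows "countable {x \<in> S. \<not> f field_differentiable at x}" (is "countable ?N")
proof -
  have "\<exists>q\<in>\<rat>. right_deriv f x < q \<and> q < left_deriv f x" if x: "x \<in> ?N" for x
  proof -
    have "x \<in> S" "right_deriv f x \<noteq> left_deriv f x"
      using x concave_on_DERIV_iff[OF f S, of x] by (auto simp: field_differentiable_def)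
    then have "right_deriv f x < left_deriv f x"
      using concave_on_one_sided_derivs(3)[OF f S, of x] by simp
    then show ?thesis
      using Rats_dense_in_real by blast
  qed
  then have "\<exists>q. \<forall>x\<in>?N. q x \<in> \<rat> \<and> right_deriv f x < q x \<and> q x < left_deriv f x"
    by (intro bchoice) blast
  then obtain q where q: "\<And>x. x \<in> ?N \<Longrightarrow> q x \<in> \<rat> \<and> right_deriv f x < q x \<and> q x < left_deriv f x"
    by blast
  have less: "q y < q x" if "x \<in> ?N" "y \<in> ?N" "x < y" for x y
  proof -
    have "left_deriv f y * (y - x) \<le> right_deriv f x * (y - x)"
      using concave_on_one_sided_derivs(4)[OF f S, of x y]
        concave_on_one_sided_derivs(5)[OF f S, of y x] that by (simp add: algebra_simps)
    then have "left_deriv f y \<le> right_deriv f x"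
      using that by simp
    then show ?thesis
      using q[OF that(1)] q[OF that(2)] by linarith
  qed
  have "inj_on q ?N"
    using less by (intro linorder_inj_onI') fastforce
  moreover have "q ` ?N \<subseteq> \<rat>"
    using q by auto
  ultimately show ?thesis
    using countable_image_inj_on[of q ?N] countable_subset[OF _ countable_rat] by blast
qed

text \<open>
  The function rises from \<open>0\<close> to its maximum and falls back to \<open>0\<close>, so its total variation is twice
  the maximum. The points of non-differentiability, where \<^const>\<open>deriv\<close> is an arbitrary value, are
  countable and hence invisible to the integral.
\<close>
lemma nn_integral_abs_deriv_concave:
  fixes f :: "real \<Rightarrow> real"
  assumes f: "concave_on {a..b} f" and cont: "continuous_on {a..b} f"
    and zero: "f a = 0" "f b = 0" and x0: "x0 \<in> {a..b}" and max: "\<And>x. x \<in> {a..b} \<Longrightarrow> f x \<le> f x0"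
  shows "(\<integral>\<^sup>+x. indicator {a<..<b} x * ennreal \<bar>deriv f x\<bar> \<partial>lborel) = ennreal (2 * f x0)"
proof -
  define N where "N = {x \<in> {a<..<b}. \<not> f field_differentiable at x}"
  have f': "concave_on {a<..<b} f"
    using f unfolding concave_on_def by (rule convex_on_subset) auto
  have N: "countable N"
    unfolding N_def by (rule countable_not_differentiable_concave_on[OF f']) simp
  have D: "DERIV f x :> deriv f x" and tan: "f x0 \<le> f x + deriv f x * (x0 - x)"
    if x: "x \<in> {a<..<b} - N" for x
  proof -
    show D: "DERIV f x :> deriv f x"
      using that by (auto simp: N_def DERIV_deriv_iff_field_differentiable)
    have "right_deriv f x = deriv f x" "left_deriv f x = deriv f x"
      using D x concave_on_DERIV_iff[OF f', of x] by auto
    have tan': "f y \<le> f x + deriv f x * (y - x)" if "y \<in> {a<..<b}" for y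
      using D x concave_on_DERIV_iff[OF f', of x "deriv f x"]
        concave_on_one_sided_derivs(4,5)[OF f', of x y] that
      by (cases "x < y"; cases "y < x") auto
    have c: "closure {a<..<b} = {a..b}"
      using x by (intro closure_greaterThanLessThan) auto
    have cl: "closed {y \<in> {a..b}. f y \<le> f x + deriv f x * (y - x)}"
      by (intro continuous_on_closed_Collect_le cont continuous_intros)
    have "{a..b} \<subseteq> {y \<in> {a..b}. f y \<le> f x + deriv f x * (y - x)}"
      unfolding c[symmetric] by (rule closure_minimal) (use tan' cl c in auto)
    then show "f x0 \<le> f x + deriv f x * (x0 - x)"
      using x0 by auto
  qed
  have up: "0 \<le> deriv f x" if "x \<in> {a<..<x0} - N" for x
  proof -
    have "0 \<le> deriv f x * (x0 - x)"
      using tan[of x] max[of x] that x0 by auto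
    then show ?thesis
      using that by (simp add: zero_le_mult_iff)
  qed
  have down: "deriv f x \<le> 0" if "x \<in> {x0<..<b} - N" for x
  proof -
    have "0 \<le> deriv f x * (x0 - x)"
      using tan[of x] max[of x] that x0 by auto
    then show ?thesis
      using that by (simp add: zero_le_mult_iff)
  qed
  have "((\<lambda>x. \<bar>deriv f x\<bar>) has_integral (f x0 - f a)) {a..x0}"
  proof (intro fundamental_theorem_of_calculus_countable[OF N])
    show "continuous_on {a..x0} f"
      using x0 by (intro continuous_on_subset[OF cont]) auto
    show "(f has_real_derivative \<bar>deriv f x\<bar>) (at x)" if "x \<in> {a<..<x0} - N" for x
      using D[of x] up[OF that] that x0 by simp
  qed (use x0 in auto)
  moreover have "((\<lambda>x. \<bar>deriv f x\<bar>) has_integral ((- f b) - (- f x0))) {x0..b}"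
  proof (intro fundamental_theorem_of_calculus_countable[OF N])
    show "continuous_on {x0..b} (\<lambda>x. - f x)"
      using x0 by (intro continuous_intros continuous_on_subset[OF cont]) auto
    show "((\<lambda>x. - f x) has_real_derivative \<bar>deriv f x\<bar>) (at x)" if "x \<in> {x0<..<b} - N" for x
      using DERIV_minus[OF D[of x]] down[OF that] that x0 by simp
  qed (use x0 in auto)
  ultimately have "((\<lambda>x. \<bar>deriv f x\<bar>) has_integral (2 * f x0)) {a..b}"
    using has_integral_combine[of a x0 b "\<lambda>x. \<bar>deriv f x\<bar>"] x0 zero by fastforce
  then have "((\<lambda>x. \<bar>deriv f x\<bar>) has_integral (2 * f x0)) {a<..<b}"
    by (simp add: has_integral_Icc_iff_Ioo)
  from nn_integral_has_integral_lebesgue[OF _ this] show ?thesis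
    by (simp add: ennreal_mult ennreal_indicator)
qed


section \<open>Horizontal slices\<close>

definition concave_vanishing_on_frontier :: "(real \<times> real) set \<Rightarrow> (real \<times> real \<Rightarrow> real) \<Rightarrow> bool" where
  "concave_vanishing_on_frontier \<Omega> u \<longleftrightarrow>
     continuous_on \<Omega> u \<and> concave_on \<Omega> u \<and> (\<forall>p\<in>frontier \<Omega>. u p = 0)"

lemma horizontal_slice:
  assumes \<Omega>: "convex_compact_domain \<Omega>" and p: "(x0, y) \<in> interior \<Omega>"
  obtains a b where "{x. (x, y) \<in> interior \<Omega>} = {a<..<b}" "a < b"
    "(a, y) \<in> frontier \<Omega>" "(b, y) \<in> frontier \<Omega>" "\<And>x. x \<in> {a..b} \<Longrightarrow> (x, y) \<in> \<Omega>"
proof -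
  have "compact \<Omega>" "convex \<Omega>"
    using \<Omega> by (auto simp: convex_compact_domain_def)
  define I where "I = {x. (x, y) \<in> interior \<Omega>}"
  have cont: "continuous_on A (\<lambda>x. (x, y))" for A :: "real set"
    by (intro continuous_intros)
  have "open ((\<lambda>x. (x, y)) -` interior \<Omega>)"
    using cont by (intro open_vimage) auto
  then have "open I"
    by (simp add: I_def vimage_def)
  have "convex I"
  proof (rule convexI)
    fix s t u v :: real
    assume "s \<in> I" "t \<in> I" "0 \<le> u" "0 \<le> v" "u + v = 1"
    then have "u *\<^sub>R (s, y) + v *\<^sub>R (t, y) \<in> interior \<Omega>"
      using convex_interior[OF \<open>convex \<Omega>\<close>] by (intro convexD) (auto simp: I_def)
    then show "u *\<^sub>R s + v *\<^sub>R t \<in> I"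
      using \<open>u + v = 1\<close> by (simp add: I_def flip: distrib_right)
  qed
  have "I \<subseteq> fst ` \<Omega>"
    using interior_subset by (force simp: I_def)
  moreover have "bounded (fst ` \<Omega>)"
    using \<open>compact \<Omega>\<close> by (intro compact_imp_bounded compact_continuous_image continuous_intros)
  ultimately have "compact (closure I)"
    using bounded_subset by (auto simp: compact_closure)
  moreover have "connected (closure I)"
    using \<open>convex I\<close> by (intro connected_imp_connected_closure convex_connected)
  ultimately obtain a b where ab: "closure I = {a..b}"
    using connected_compact_interval_1[of "closure I"] by auto
  have I: "I = {a<..<b}"
    using convex_interior_closure[OF \<open>convex I\<close>] \<open>open I\<close> ab by (simp add: interior_open)
  have "x0 \<in> I"
    using p by (simp add: I_def)
  then have "a < b"
    using I by auto
  have sub: "(x, y) \<in> \<Omega>" if "x \<in> {a..b}" for x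
  proof -
    have "(\<lambda>x. (x, y)) ` closure I \<subseteq> closure ((\<lambda>x. (x, y)) ` I)"
      using cont by (intro image_closure_subset closure_subset) auto
    also have "\<dots> \<subseteq> \<Omega>"
      using interior_subset compact_imp_closed[OF \<open>compact \<Omega>\<close>]
      by (intro closure_minimal) (auto simp: I_def)
    finally show ?thesis
      using that ab by auto
  qed
  have fr: "(x, y) \<in> frontier \<Omega>" if "x \<in> {a..b}" "x \<notin> I" for x
    using sub[OF that(1)] that(2) closure_subset by (auto simp: frontier_def I_def)
  show thesis
    using that[of a b] I \<open>a < b\<close> sub fr[of a] fr[of b] by (simp add: I_def)
qed

lemma concave_on_slice:
  fixes u :: "real \<times> real \<Rightarrow> real"
  assumes u: "concave_on \<Omega> u" and "convex I" and sub: "\<And>x. x \<in> I \<Longrightarrow> (x, y) \<in> \<Omega>"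
  shows "concave_on I (\<lambda>x. u (x, y))"
  unfolding concave_on_iff
proof (intro conjI ballI allI impI)
  fix s t v w :: real
  assume st: "s \<in> I" "t \<in> I" and vw: "0 \<le> v" "0 \<le> w" "v + w = 1"
  have "v * u (s, y) + w * u (t, y) \<le> u (v *\<^sub>R (s, y) + w *\<^sub>R (t, y))"
    using u sub[OF st(1)] sub[OF st(2)] vw unfolding concave_on_iff by blast
  also have "v *\<^sub>R (s, y) + w *\<^sub>R (t, y) = (v *\<^sub>R s + w *\<^sub>R t, y)"
    using vw by (simp flip: distrib_right)
  finally show "v * u (s, y) + w * u (t, y) \<le> u (v *\<^sub>R s + w *\<^sub>R t, y)" .
qed fact

text \<open>
  In the second claim the real number is the maximum of \<open>u\<close> on the line at height \<open>y\<close>. It is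
  described by a bound from either side, since this is how the maximum enters the two estimates of the norm.
\<close>
lemma
  assumes \<Omega>: "convex_compact_domain \<Omega>" and u: "concave_vanishing_on_frontier \<Omega> u"
    and p: "(x0, y) \<in> interior \<Omega>"
  shows slice_nonneg: "0 \<le> u (x0, y)"
    and slice_integral: "\<exists>x\<ge>0. (\<forall>t. (t, y) \<in> interior \<Omega> \<longrightarrow> u (t, y) \<le> x) \<and>
      (x \<in> (\<lambda>t. u (t, y)) ` {t. (t, y) \<in> \<Omega>}) \<and>
      (\<integral>\<^sup>+x. indicator (interior \<Omega>) (x, y) * ennreal \<bar>partial_x u (x, y)\<bar> \<partial>lborel) = ennreal (2 * x)"
proof -
  obtain a b where ab: "{x. (x, y) \<in> interior \<Omega>} = {a<..<b}" "a < b"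
    and fr: "(a, y) \<in> frontier \<Omega>" "(b, y) \<in> frontier \<Omega>" and sub: "\<And>x. x \<in> {a..b} \<Longrightarrow> (x, y) \<in> \<Omega>"
    using horizontal_slice[OF \<Omega> p] by blast
  define f where "f = (\<lambda>x. u (x, y))"
  have zero: "f a = 0" "f b = 0"
    using u fr by (auto simp: f_def concave_vanishing_on_frontier_def)
  have cont: "continuous_on {a..b} f"
    unfolding f_def
  proof (rule continuous_on_compose2[of \<Omega> u _ "\<lambda>x. (x, y)"])
    show "continuous_on \<Omega> u"
      using u by (simp add: concave_vanishing_on_frontier_def)
    show "continuous_on {a..b} (\<lambda>x. (x, y))"
      by (intro continuous_intros)
    show "(\<lambda>x. (x, y)) ` {a..b} \<subseteq> \<Omega>"
      using sub by blast
  qed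
  have conc: "concave_on {a..b} f"
    unfolding f_def using u sub
    by (intro concave_on_slice[of \<Omega>]) (auto simp: concave_vanishing_on_frontier_def)
  have nonneg: "0 \<le> f x" if "x \<in> {a..b}" for x
    using concave_onD_Icc'[OF conc that] zero by simp
  have x0: "x0 \<in> {a..b}"
    using p ab(1) by (metis greaterThanLessThan_subseteq_atLeastAtMost_iff order_refl mem_Collect_eq subsetD)
  then show "0 \<le> u (x0, y)"
    using nonneg by (simp add: f_def)
  obtain x1 where x1: "x1 \<in> {a..b}" and max: "\<And>x. x \<in> {a..b} \<Longrightarrow> f x \<le> f x1"
    using continuous_attains_sup[of "{a..b}" f] cont ab(2) by auto
  have "indicator (interior \<Omega>) (x, y) = (indicator {a<..<b} x :: ennreal)" for x
    unfolding ab(1)[symmetric] by (simp add: indicator_def)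
  then have int: "(\<integral>\<^sup>+x. indicator (interior \<Omega>) (x, y) * ennreal \<bar>partial_x u (x, y)\<bar> \<partial>lborel) = ennreal (2 * f x1)"
    using nn_integral_abs_deriv_concave[OF conc cont zero x1 max] by (simp add: partial_x_def f_def)
  have "u (t, y) \<le> f x1" if "(t, y) \<in> interior \<Omega>" for t
  proof -
    have "t \<in> {a<..<b}" using that ab(1) by blast
    then show ?thesis using max[of t] by (simp add: f_def)
  qed
  then show "\<exists>x\<ge>0. (\<forall>t. (t, y) \<in> interior \<Omega> \<longrightarrow> u (t, y) \<le> x) \<and>
      (x \<in> (\<lambda>t. u (t, y)) ` {t. (t, y) \<in> \<Omega>}) \<and>
      (\<integral>\<^sup>+x. indicator (interior \<Omega>) (x, y) * ennreal \<bar>partial_x u (x, y)\<bar> \<partial>lborel) = ennreal (2 * x)"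
    using nonneg[OF x1] int x1 sub by (intro exI[of _ "f x1"]) (auto simp: f_def)
qed

lemma concave_vanishing_nonneg:
  assumes "convex_compact_domain \<Omega>" "concave_vanishing_on_frontier \<Omega> u" "p \<in> \<Omega>"
  shows "0 \<le> u p"
proof (cases "p \<in> interior \<Omega>")
  case True
  then show ?thesis
    using slice_nonneg[OF assms(1,2), of "fst p" "snd p"] by simp
next
  case False
  then have "p \<in> frontier \<Omega>"
    using assms closure_subset by (auto simp: frontier_def)
  then show ?thesis
    using assms by (simp add: concave_vanishing_on_frontier_def)
qed

text \<open>
  The values of \<open>u\<close> outside \<open>\<Omega>\<close> are unconstrained, so the difference quotients are formed with the
  extension of \<open>u\<close> by zero. This extension is Borel because \<open>\<Omega>\<close> is closed, and it has the same derivatives as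
  \<open>u\<close> at interior points.
\<close>
lemma borel_measurable_partial_x:
  assumes \<Omega>: "convex_compact_domain \<Omega>" and u: "concave_vanishing_on_frontier \<Omega> u"
  shows "(\<lambda>p. indicator (interior \<Omega>) p * ennreal \<bar>partial_x u p\<bar>) \<in> borel_measurable borel"
proof -
  define v where "v p = indicator \<Omega> p *\<^sub>R u p" for p
  have "closed \<Omega>"
    using \<Omega> compact_imp_closed by (auto simp: convex_compact_domain_def)
  then have v[measurable]: "v \<in> borel_measurable borel"
    unfolding v_def using u
    by (intro borel_measurable_continuous_on_indicator) (auto simp: concave_vanishing_on_frontier_def)
  define r where "r p = right_deriv (\<lambda>t. v (t, snd p)) (fst p)" for p :: "real \<times> real"
  define l where "l p = left_deriv (\<lambda>t. v (t, snd p)) (fst p)" for p :: "real \<times> real"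
  have shift: "(\<lambda>p. v (fst p + h, snd p)) \<in> borel_measurable borel" for h
    by (intro measurable_compose[OF _ v] borel_measurable_continuous_onI continuous_intros)
  have [measurable]: "r \<in> borel_measurable borel"
    unfolding r_def right_deriv_def
    by (intro borel_measurable_lim_metric borel_measurable_divide borel_measurable_diff shift) auto
  have [measurable]: "l \<in> borel_measurable borel"
    unfolding l_def left_deriv_def
    by (intro borel_measurable_lim_metric borel_measurable_divide borel_measurable_diff shift) auto
  have eq: "partial_x u p = (if r p = l p then r p else (SOME D. False))" if p: "p \<in> interior \<Omega>" for p
  proof -
    obtain x y where xy: "p = (x, y)" by (cases p)
    define I where "I = {t. (t, y) \<in> interior \<Omega>}"
    have "open ((\<lambda>t. (t, y)) -` interior \<Omega>)"
      by (intro open_vimage continuous_intros) auto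
    then have "open I"
      by (simp add: I_def vimage_def)
    have "x \<in> I"
      using p by (simp add: I_def xy)
    have vu: "v (t, y) = u (t, y)" if "t \<in> I" for t
      using that interior_subset[of \<Omega>] by (auto simp: v_def I_def indicator_def)
    obtain a b where "I = {a<..<b}"
      using horizontal_slice[OF \<Omega>, of x y] p unfolding I_def xy by metis
    then have "convex I" by simp
    have "concave_on I (\<lambda>t. u (t, y))"
      using u interior_subset \<open>convex I\<close>
      by (intro concave_on_slice[of \<Omega>]) (auto simp: concave_vanishing_on_frontier_def I_def)
    then have "concave_on I (\<lambda>t. v (t, y))"
      using vu \<open>convex I\<close> by (simp add: concave_on_iff convexD del: real_scaleR_def)
    from deriv_concave_on[OF this \<open>open I\<close> \<open>x \<in> I\<close>]
    have "deriv (\<lambda>t. v (t, y)) x = (if r p = l p then r p else (SOME D. False))"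
      by (simp add: r_def l_def xy)
    moreover have "deriv (\<lambda>t. v (t, y)) x = deriv (\<lambda>t. u (t, y)) x"
      using eventually_nhds_in_open[OF \<open>open I\<close> \<open>x \<in> I\<close>]
      by (intro deriv_cong_ev refl) (auto elim!: eventually_mono simp: vu)
    ultimately show ?thesis
      by (simp add: partial_x_def xy)
  qed
  have "(\<lambda>p. indicator (interior \<Omega>) p * ennreal \<bar>partial_x u p\<bar>)
      = (\<lambda>p. indicator (interior \<Omega>) p * ennreal \<bar>if r p = l p then r p else (SOME D. False)\<bar>)"
    by (auto simp: fun_eq_iff indicator_def eq)
  also have "\<dots> \<in> borel_measurable borel"
    by measurable
  finally show ?thesis .
qed

text \<open>
  Nothing is known about \<open>f\<close> on the frontier, not even measurability; this is harmless because the frontier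
  of a convex set is a null set.
\<close>
lemma L1_norm_on_eq_interior:
  assumes "convex_compact_domain \<Omega>"
  shows "L1_norm_on \<Omega> f = (\<integral>\<^sup>+p. indicator (interior \<Omega>) p * ennreal \<bar>f p\<bar> \<partial>lborel)"
proof -
  have c: "closed \<Omega>" and "convex \<Omega>"
    using assms compact_imp_closed by (auto simp: convex_compact_domain_def)
  have "frontier \<Omega> \<in> null_sets lborel"
    using negligible_convex_frontier[OF \<open>convex \<Omega>\<close>]
    by (auto simp: negligible_iff_null_sets null_sets_completion_iff)
  then have "AE p in lborel. p \<notin> frontier \<Omega>"
    by (rule AE_not_in)
  then have "AE p in lborel. ennreal \<bar>f p\<bar> * indicator \<Omega> p = indicator (interior \<Omega>) p * ennreal \<bar>f p\<bar>"
    using interior_subset[of \<Omega>] c by (auto simp: frontier_def indicator_def elim!: eventually_mono)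
  then show ?thesis
    unfolding L1_norm_on_def by (rule nn_integral_cong_AE)
qed

lemma L1_norm_partial_x_iterated:
  assumes "convex_compact_domain \<Omega>" "concave_vanishing_on_frontier \<Omega> u"
  shows "L1_norm_on \<Omega> (partial_x u) =
    (\<integral>\<^sup>+y. \<integral>\<^sup>+x. indicator (interior \<Omega>) (x, y) * ennreal \<bar>partial_x u (x, y)\<bar> \<partial>lborel \<partial>lborel)"
  using lborel_pair.nn_integral_snd[of "\<lambda>p. indicator (interior \<Omega>) p * ennreal \<bar>partial_x u p\<bar>"]
    borel_measurable_partial_x[OF assms]
  by (simp add: lborel_prod L1_norm_on_eq_interior[OF assms(1)])


section \<open>The norm of a partial derivative\<close>

lemma has_integral_tent:
  fixes c d y0 :: real
  assumes "c < y0" "y0 < d"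
  shows "((\<lambda>y. 2 * (if y \<le> y0 then (y - c) / (y0 - c) else (d - y) / (d - y0))) has_integral (d - c)) {c..d}"
    (is "(?t has_integral _) _")
proof -
  have "(?t has_integral ((y0 - c)\<^sup>2 / (y0 - c) - (c - c)\<^sup>2 / (y0 - c))) {c..y0}"
    using assms
    by (intro fundamental_theorem_of_calculus_interior)
       (auto intro!: derivative_eq_intros continuous_intros simp flip: has_real_derivative_iff_has_vector_derivative)
  moreover have "((\<lambda>y. - ((d - y)\<^sup>2 / k)) has_real_derivative 2 * ((d - y) / k)) (at y)" for y k :: real
    by (cases "k = 0") (auto intro!: derivative_eq_intros simp: field_simps)
  then have "(?t has_integral (- ((d - d)\<^sup>2 / (d - y0)) - - ((d - y0)\<^sup>2 / (d - y0)))) {y0..d}"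
    using assms
    by (intro fundamental_theorem_of_calculus_interior)
       (auto intro!: continuous_intros simp flip: has_real_derivative_iff_has_vector_derivative)
  ultimately have "(?t has_integral ((y0 - c)\<^sup>2 / (y0 - c) - (c - c)\<^sup>2 / (y0 - c)
      + (- ((d - d)\<^sup>2 / (d - y0)) - - ((d - y0)\<^sup>2 / (d - y0))))) {c..d}"
    using assms by (intro has_integral_combine[of c y0 d]) simp_all
  then show ?thesis
    using assms by (simp add: power2_eq_square)
qed

text \<open>
  Since \<open>u \<ge> 0\<close> at \<open>q\<close>, concavity along the segment from \<open>q\<close> to \<open>p0\<close> makes \<open>u\<close> at least linear in the
  distance from \<open>q\<close>.
\<close>
lemma concave_peak_scaling:
  assumes "convex_compact_domain \<Omega>" "concave_vanishing_on_frontier \<Omega> u"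
    and p0: "p0 \<in> interior \<Omega>" and q: "q \<in> \<Omega>" and t: "0 < t" "t \<le> 1"
  shows "(1 - t) *\<^sub>R q + t *\<^sub>R p0 \<in> interior \<Omega>" "t * u p0 \<le> u ((1 - t) *\<^sub>R q + t *\<^sub>R p0)"
proof -
  have \<Omega>: "compact \<Omega>" "convex \<Omega>"
    using assms(1) by (auto simp: convex_compact_domain_def)
  have "q - t *\<^sub>R (q - p0) \<in> interior \<Omega>"
    using \<Omega> p0 q t closure_subset by (intro mem_interior_closure_convex_shrink) auto
  then show "(1 - t) *\<^sub>R q + t *\<^sub>R p0 \<in> interior \<Omega>"
    by (simp add: algebra_simps)
  have "concave_on \<Omega> u"
    using assms(2) by (simp add: concave_vanishing_on_frontier_def)
  from concave_onD[OF this, of t q p0]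
  have "(1 - t) * u q + t * u p0 \<le> u ((1 - t) *\<^sub>R q + t *\<^sub>R p0)"
    using t q p0 interior_subset by auto
  moreover have "0 \<le> (1 - t) * u q"
    using t concave_vanishing_nonneg[OF assms(1,2) q] by simp
  ultimately show "t * u p0 \<le> u ((1 - t) *\<^sub>R q + t *\<^sub>R p0)"
    by linarith
qed

text \<open>
  The upper bound replaces the maximum over each horizontal line by the global maximum, the lower
  bound by the tent function over \<open>[c, d]\<close> with apex above the height of the maximum point.
\<close>
lemma L1_norm_partial_x_bounds:
  assumes \<Omega>: "convex_compact_domain \<Omega>" and u: "concave_vanishing_on_frontier \<Omega> u"
    and p0: "p0 \<in> \<Omega>" and max: "\<And>p. p \<in> \<Omega> \<Longrightarrow> u p \<le> u p0" and pos: "0 < u p0"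
    and cd: "snd ` \<Omega> = {c..d}"
  shows "ennreal (u p0 * (d - c)) \<le> L1_norm_on \<Omega> (partial_x u)"
    and "L1_norm_on \<Omega> (partial_x u) \<le> ennreal (2 * u p0 * (d - c))"
proof -
  define J where "J y = (\<integral>\<^sup>+x. indicator (interior \<Omega>) (x, y) * ennreal \<bar>partial_x u (x, y)\<bar> \<partial>lborel)" for y
  have L1: "L1_norm_on \<Omega> (partial_x u) = (\<integral>\<^sup>+y. J y \<partial>lborel)"
    unfolding J_def by (rule L1_norm_partial_x_iterated[OF \<Omega> u])
  have "p0 \<notin> frontier \<Omega>"
    using u pos by (auto simp: concave_vanishing_on_frontier_def)
  then have p0i: "p0 \<in> interior \<Omega>"
    using p0 closure_subset by (auto simp: frontier_def)
  define y0 where "y0 = snd p0"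
  have "c \<le> d"
    using cd p0 by (metis atLeastatMost_empty_iff2 empty_iff image_is_empty)
  have "y0 \<in> interior {c..d}"
    unfolding y0_def cd[symmetric] using p0i
      interior_maximal[OF image_mono[OF interior_subset] open_image_snd[OF open_interior]] by blast
  then have y0: "c < y0" "y0 < d"
    by auto
  have upper: "J y \<le> indicator {c..d} y * ennreal (2 * u p0)" for y
  proof (cases "\<exists>x. (x, y) \<in> interior \<Omega>")
    case True
    then obtain x where x: "(x, y) \<in> interior \<Omega>" by blast
    then have "y \<in> {c..d}"
      using cd interior_subset by force
    moreover obtain v where "v \<in> (\<lambda>t. u (t, y)) ` {t. (t, y) \<in> \<Omega>}" "J y = ennreal (2 * v)"
      using slice_integral[OF \<Omega> u x] unfolding J_def by blast
    ultimately show ?thesis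
      using max by (auto intro!: ennreal_leI)
  next
    case False
    then have "J y = 0"
      by (simp add: J_def indicator_def)
    then show ?thesis by simp
  qed
  have "L1_norm_on \<Omega> (partial_x u) \<le> (\<integral>\<^sup>+y. indicator {c..d} y * ennreal (2 * u p0) \<partial>lborel)"
    unfolding L1 by (intro nn_integral_mono upper)
  also have "\<dots> = ennreal (2 * u p0 * (d - c))"
    using \<open>c \<le> d\<close> pos by (simp add: nn_integral_multc ennreal_mult' mult.commute)
  finally show "L1_norm_on \<Omega> (partial_x u) \<le> ennreal (2 * u p0 * (d - c))" .

  define h where "h y = (if y \<le> y0 then (y - c) / (y0 - c) else (d - y) / (d - y0))" for y
  have lower: "ennreal (2 * (h y * u p0)) \<le> J y" if y: "y \<in> {c<..<d}" for y
  proof -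
    have h: "0 < h y" "h y \<le> 1"
      using y y0 by (auto simp: h_def)
    obtain q where q: "q \<in> \<Omega>" "y = (1 - h y) * snd q + h y * y0"
    proof (cases "y \<le> y0")
      case True
      obtain q where "q \<in> \<Omega>" "snd q = c"
        using cd \<open>c \<le> d\<close> by (metis atLeastAtMost_iff imageE order_refl)
      moreover have "h y * (y0 - c) = y - c"
        using True y0 by (simp add: h_def)
      then have "y = (1 - h y) * c + h y * y0"
        by (simp add: algebra_simps)
      ultimately show ?thesis
        using that by blast
    next
      case False
      obtain q where "q \<in> \<Omega>" "snd q = d"
        using cd \<open>c \<le> d\<close> by (metis atLeastAtMost_iff imageE order_refl)
      moreover have "h y * (d - y0) = d - y"
        using False y0 by (simp add: h_def)
      then have "y = (1 - h y) * d + h y * y0"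
        by (simp add: algebra_simps)
      ultimately show ?thesis
        using that by blast
    qed
    define z where "z = (1 - h y) *\<^sub>R q + h y *\<^sub>R p0"
    have z: "z = (fst z, y)"
      using q(2) by (simp add: z_def prod_eq_iff y0_def)
    have "z \<in> interior \<Omega>" "h y * u p0 \<le> u z"
      unfolding z_def using concave_peak_scaling[OF \<Omega> u p0i q(1) h] by auto
    then have zi: "(fst z, y) \<in> interior \<Omega>" "h y * u p0 \<le> u (fst z, y)"
      using z by simp_all
    then obtain v where "u (fst z, y) \<le> v" "J y = ennreal (2 * v)"
      using slice_integral[OF \<Omega> u zi(1)] unfolding J_def by blast
    then show ?thesis
      using zi(2) by (auto intro: ennreal_leI)
  qed
  have "((\<lambda>y. u p0 * (2 * h y)) has_integral (u p0 * (d - c))) {c<..<d}"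
    using has_integral_mult_right[OF has_integral_tent[OF y0]]
    by (simp add: h_def has_integral_Icc_iff_Ioo)
  moreover have "0 \<le> u p0 * (2 * h y)" if "y \<in> {c<..<d}" for y
    using that y0 pos by (auto simp: h_def)
  ultimately have "ennreal (u p0 * (d - c)) = (\<integral>\<^sup>+y. indicator {c<..<d} y * (u p0 * (2 * h y)) \<partial>lborel)"
    by (intro nn_integral_has_integral_lebesgue[symmetric])
  also have "\<dots> \<le> (\<integral>\<^sup>+y. J y \<partial>lborel)"
  proof (rule nn_integral_mono)
    fix y :: real
    show "ennreal (indicator {c<..<d} y * (u p0 * (2 * h y))) \<le> J y"
      using lower[of y] by (cases "y \<in> {c<..<d}") (simp_all add: mult.left_commute mult.commute)
  qed
  finally show "ennreal (u p0 * (d - c)) \<le> L1_norm_on \<Omega> (partial_x u)"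
    by (simp add: L1)
qed


section \<open>Exchanging the coordinates\<close>

lemma linear_swap: "linear (prod.swap :: real \<times> real \<Rightarrow> real \<times> real)"
  by (intro linearI) (auto simp: prod_eq_iff)

lemma interior_swap: "interior (prod.swap ` \<Omega>) = prod.swap ` interior (\<Omega> :: (real \<times> real) set)"
  by (rule interior_bijective_linear_image[OF linear_swap]) simp

lemma frontier_swap: "frontier (prod.swap ` \<Omega>) = prod.swap ` frontier (\<Omega> :: (real \<times> real) set)"
  using closure_injective_linear_image[OF linear_swap, of \<Omega>]
  by (simp add: frontier_def interior_swap image_set_diff)

lemma convex_compact_domain_swap:
  assumes "convex_compact_domain \<Omega>"
  shows "convex_compact_domain (prod.swap ` \<Omega>)"
  unfolding convex_compact_domain_def
proof (intro conjI)
  show "compact (prod.swap ` \<Omega>)"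
    using assms by (intro compact_continuous_image continuous_on_swap) (simp add: convex_compact_domain_def)
  show "convex (prod.swap ` \<Omega>)"
    using assms by (intro convex_linear_image linear_swap) (simp add: convex_compact_domain_def)
  show "interior (prod.swap ` \<Omega>) \<noteq> {}"
    using assms by (simp add: interior_swap convex_compact_domain_def)
qed

lemma concave_vanishing_swap:
  assumes "concave_vanishing_on_frontier \<Omega> u"
  shows "concave_vanishing_on_frontier (prod.swap ` \<Omega>) (u \<circ> prod.swap)"
  unfolding concave_vanishing_on_frontier_def
proof (intro conjI)
  have u: "continuous_on \<Omega> u" "concave_on \<Omega> u" "\<forall>p\<in>frontier \<Omega>. u p = 0"
    using assms by (auto simp: concave_vanishing_on_frontier_def)
  show "continuous_on (prod.swap ` \<Omega>) (u \<circ> prod.swap)"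
    using u by (intro continuous_on_compose continuous_on_swap) (simp add: image_image)
  have "convex (prod.swap ` \<Omega>)"
    using u(2) by (intro convex_linear_image linear_swap) (simp add: concave_on_iff)
  then show "concave_on (prod.swap ` \<Omega>) (u \<circ> prod.swap)"
    unfolding concave_on_iff
  proof (intro conjI ballI allI impI)
    fix p q :: "real \<times> real" and s t :: real
    assume pq: "p \<in> prod.swap ` \<Omega>" "q \<in> prod.swap ` \<Omega>" and st: "0 \<le> s" "0 \<le> t" "s + t = 1"
    have "prod.swap p \<in> \<Omega>" "prod.swap q \<in> \<Omega>"
      using pq by auto
    then have "s * u (prod.swap p) + t * u (prod.swap q) \<le> u (s *\<^sub>R prod.swap p + t *\<^sub>R prod.swap q)"
      using u(2) st unfolding concave_on_iff by blast
    also have "s *\<^sub>R prod.swap p + t *\<^sub>R prod.swap q = prod.swap (s *\<^sub>R p + t *\<^sub>R q)"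
      by (simp add: prod_eq_iff)
    finally show "s * (u \<circ> prod.swap) p + t * (u \<circ> prod.swap) q \<le> (u \<circ> prod.swap) (s *\<^sub>R p + t *\<^sub>R q)"
      by simp
  qed
  show "\<forall>p\<in>frontier (prod.swap ` \<Omega>). (u \<circ> prod.swap) p = 0"
    using u(3) by (auto simp: frontier_swap)
qed

text \<open>
  The exchange of coordinates preserves Lebesgue measure; the change of variables uses the
  measurability of the partial derivative obtained above.
\<close>
lemma L1_norm_partial_y_eq:
  assumes \<Omega>: "convex_compact_domain \<Omega>" and u: "concave_vanishing_on_frontier \<Omega> u"
  shows "L1_norm_on \<Omega> (partial_y u) = L1_norm_on (prod.swap ` \<Omega>) (partial_x (u \<circ> prod.swap))"
proof -
  define F where "F p = indicator (interior (prod.swap ` \<Omega>)) p * ennreal \<bar>partial_x (u \<circ> prod.swap) p\<bar>" for p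
  have F: "F \<in> borel_measurable borel"
    unfolding F_def
    by (intro borel_measurable_partial_x convex_compact_domain_swap concave_vanishing_swap \<Omega> u)
  have swap: "(prod.swap :: real \<times> real \<Rightarrow> _) = (\<lambda>(x, y). (y, x))"
    by auto
  have "(lborel :: (real \<times> real) measure) = distr lborel lborel prod.swap"
    using lborel_pair.distr_pair_swap[where 'a = real and 'b = real] by (simp add: lborel_prod swap)
  then have "(\<integral>\<^sup>+p. F p \<partial>lborel) = (\<integral>\<^sup>+p. F p \<partial>distr lborel lborel prod.swap)"
    by simp
  also have "\<dots> = (\<integral>\<^sup>+p. F (prod.swap p) \<partial>lborel)"
    using F by (intro nn_integral_distr) (auto intro!: borel_measurable_continuous_onI continuous_on_swap)
  finally have "(\<integral>\<^sup>+p. F p \<partial>lborel) = (\<integral>\<^sup>+p. F (prod.swap p) \<partial>lborel)" .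
  moreover have "F (prod.swap p) = indicator (interior \<Omega>) p * ennreal \<bar>partial_y u p\<bar>" for p
    by (simp add: F_def interior_swap partial_x_def partial_y_def indicator_def inj_image_mem_iff)
  ultimately show ?thesis
    unfolding L1_norm_on_eq_interior[OF \<Omega>] L1_norm_on_eq_interior[OF convex_compact_domain_swap[OF \<Omega>]]
    by (simp add: F_def)
qed

text \<open>
  Both norms are compared with the same maximum of \<open>u\<close>, which cancels in the quotient.
\<close>
lemma U_class_ratio_bounds:
  assumes \<Omega>: "convex_compact_domain \<Omega>" and u: "u \<in> U_class_nonzero \<Omega>"
    and ab: "fst ` \<Omega> = {a..b}" "a < b" and cd: "snd ` \<Omega> = {c..d}" "c < d"
  shows "ennreal ((d - c) / (2 * (b - a))) \<le> L1_norm_on \<Omega> (partial_x u) / L1_norm_on \<Omega> (partial_y u)"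
    and "L1_norm_on \<Omega> (partial_x u) / L1_norm_on \<Omega> (partial_y u) \<le> ennreal (2 * (d - c) / (b - a))"
proof -
  have cv: "concave_vanishing_on_frontier \<Omega> u"
    using u by (auto simp: U_class_nonzero_def U_class_def concave_vanishing_on_frontier_def)
  obtain q where q: "q \<in> \<Omega>" "u q \<noteq> 0"
    using u by (auto simp: U_class_nonzero_def)
  obtain p0 where p0: "p0 \<in> \<Omega>" and max: "\<And>p. p \<in> \<Omega> \<Longrightarrow> u p \<le> u p0"
    using continuous_attains_sup[of \<Omega> u] \<Omega> cv q(1)
    unfolding convex_compact_domain_def concave_vanishing_on_frontier_def by blast
  define m where "m = u p0"
  have "0 < m"
    using concave_vanishing_nonneg[OF \<Omega> cv q(1)] q max[OF q(1)] by (simp add: m_def)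
  define A where "A = L1_norm_on \<Omega> (partial_x u)"
  define B where "B = L1_norm_on \<Omega> (partial_y u)"
  have A: "ennreal (m * (d - c)) \<le> A" "A \<le> ennreal (2 * m * (d - c))"
    using L1_norm_partial_x_bounds[OF \<Omega> cv p0 max _ cd(1)] \<open>0 < m\<close> by (simp_all add: A_def m_def)
  have "snd ` prod.swap ` \<Omega> = {a..b}"
    using ab(1) by (simp add: image_image)
  from L1_norm_partial_x_bounds[OF convex_compact_domain_swap[OF \<Omega>] concave_vanishing_swap[OF cv] _ _ _ this,
      of "prod.swap p0"]
  have B: "ennreal (m * (b - a)) \<le> B" "B \<le> ennreal (2 * m * (b - a))"
    using \<open>0 < m\<close> p0 max by (auto simp: B_def m_def L1_norm_partial_y_eq[OF \<Omega> cv])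
  have "A \<noteq> top" "B \<noteq> top"
    using A(2) B(2) by (auto simp: top_unique)
  then obtain \<alpha> \<beta> where \<alpha>: "A = ennreal \<alpha>" "0 \<le> \<alpha>" and \<beta>: "B = ennreal \<beta>" "0 \<le> \<beta>"
    by (metis ennreal_cases)
  have r: "m * (d - c) \<le> \<alpha>" "\<alpha> \<le> 2 * m * (d - c)" "m * (b - a) \<le> \<beta>" "\<beta> \<le> 2 * m * (b - a)"
    using A B \<alpha> \<beta> \<open>0 < m\<close> ab(2) cd(2) by simp_all
  have "0 < m * (b - a)" "0 < m * (d - c)"
    using \<open>0 < m\<close> ab(2) cd(2) by simp_all
  then have "0 < \<beta>"
    using r by linarith
  have AB: "A / B = ennreal (\<alpha> / \<beta>)"
    using \<alpha> \<beta> \<open>0 < \<beta>\<close> by (simp add: divide_ennreal)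
  have "(d - c) / (2 * (b - a)) = (m * (d - c)) / (2 * m * (b - a))"
    using \<open>0 < m\<close> by simp
  also have "\<dots> \<le> \<alpha> / \<beta>"
    using r \<open>0 < \<beta>\<close> \<open>0 < m * (d - c)\<close> by (intro frac_le) auto
  finally show "ennreal ((d - c) / (2 * (b - a))) \<le> L1_norm_on \<Omega> (partial_x u) / L1_norm_on \<Omega> (partial_y u)"
    using AB by (auto simp: A_def B_def intro: ennreal_leI)
  have "\<alpha> / \<beta> \<le> (2 * m * (d - c)) / (m * (b - a))"
    using r \<open>0 < m * (b - a)\<close> \<alpha>(2) by (intro frac_le) auto
  also have "\<dots> = 2 * (d - c) / (b - a)"
    using \<open>0 < m\<close> by simp
  finally show "L1_norm_on \<Omega> (partial_x u) / L1_norm_on \<Omega> (partial_y u) \<le> ennreal (2 * (d - c) / (b - a))"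
    using AB by (auto simp: A_def B_def intro: ennreal_leI)
qed

section \<open>The distance to the complement\<close>

text \<open>
  If the balls of radius \<open>r\<close> and \<open>s\<close> around \<open>x\<close> and \<open>y\<close> lie in a convex set, then so does the ball of
  radius \<open>v r + w s\<close> around \<open>v x + w y\<close>: a point of it is the same convex combination of points
  displaced proportionally from \<open>x\<close> and from \<open>y\<close>.
\<close>
lemma concave_on_infdist_compl:
  fixes S :: "'a::real_normed_vector set"
  assumes "convex S" "S \<noteq> UNIV"
  shows "concave_on S (\<lambda>p. infdist p (- S))"
  unfolding concave_on_iff
proof (intro conjI ballI allI impI)
  fix x y :: 'a and v w :: real
  assume xy: "x \<in> S" "y \<in> S" and vw: "0 \<le> v" "0 \<le> w" "v + w = 1"
  define \<rho> where "\<rho> = (\<lambda>p. infdist p (- S))"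
  define z where "z = v *\<^sub>R x + w *\<^sub>R y"
  define R where "R = v * \<rho> x + w * \<rho> y"
  have ne: "- S \<noteq> {}"
    using assms(2) by auto
  have "0 \<le> R"
    using vw by (simp add: R_def \<rho>_def infdist_nonneg)
  have near: "p + \<rho> p *\<^sub>R h \<in> S" if "p \<in> S" "norm h < 1" for p h
  proof (rule ccontr)
    assume n: "p + \<rho> p *\<^sub>R h \<notin> S"
    then have "\<rho> p \<noteq> 0"
      using that(1) by auto
    then have "0 < \<rho> p"
      using infdist_nonneg[of p "- S"] by (simp add: \<rho>_def)
    moreover have "\<rho> p \<le> \<rho> p * norm h"
      using infdist_le[of "p + \<rho> p *\<^sub>R h" "- S" p] n \<open>0 < \<rho> p\<close> by (simp add: \<rho>_def dist_norm)
    ultimately show False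
      using that(2) by simp
  qed
  have "R \<le> dist z q" if "q \<in> - S" for q
  proof (rule ccontr)
    assume "\<not> R \<le> dist z q"
    then have less: "dist z q < R" and "0 < R"
      using zero_le_dist[of z q] by linarith+
    define h where "h = (1 / R) *\<^sub>R (q - z)"
    have "norm h < 1"
      using less \<open>0 < R\<close> by (simp add: h_def dist_norm norm_minus_commute divide_simps)
    then have "v *\<^sub>R (x + \<rho> x *\<^sub>R h) + w *\<^sub>R (y + \<rho> y *\<^sub>R h) \<in> S"
      using xy vw by (intro convexD[OF assms(1)] near)
    also have "v *\<^sub>R (x + \<rho> x *\<^sub>R h) + w *\<^sub>R (y + \<rho> y *\<^sub>R h) = z + R *\<^sub>R h"
      by (simp add: z_def R_def algebra_simps)
    also have "\<dots> = q"
      using \<open>0 < R\<close> by (simp add: h_def)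
    finally show False
      using that by simp
  qed
  then show "v * infdist x (- S) + w * infdist y (- S) \<le> infdist (v *\<^sub>R x + w *\<^sub>R y) (- S)"
    using ne by (auto simp: infdist_notempty R_def \<rho>_def z_def intro!: cINF_greatest)
qed fact

lemma abs_deriv_le_Lipschitz:
  fixes f :: "real \<Rightarrow> real"
  assumes "\<And>s t. \<bar>f s - f t\<bar> \<le> \<bar>s - t\<bar>" and "f field_differentiable at x"
  shows "\<bar>deriv f x\<bar> \<le> 1"
proof -
  have lim: "((\<lambda>h. (f (x + h) - f x) / h) \<longlongrightarrow> deriv f x) (at 0)"
    using assms(2) by (simp add: DERIV_deriv_iff_field_differentiable[symmetric] DERIV_def)
  have "norm ((f (x + h) - f x) / h) \<le> 1" for h
    using assms(1)[of "x + h" x] by (cases "h = 0") (simp_all add: divide_simps)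
  then show ?thesis
    using Lim_norm_ubound[OF _ lim, of 1] by simp
qed

lemma U_class_nonzero_nonempty:
  assumes \<Omega>: "convex_compact_domain \<Omega>"
  shows "U_class_nonzero \<Omega> \<noteq> {}"
proof -
  define \<rho> where "\<rho> = (\<lambda>p. infdist p (- \<Omega>))"
  have c: "compact \<Omega>" "convex \<Omega>" "interior \<Omega> \<noteq> {}"
    using \<Omega> by (auto simp: convex_compact_domain_def)
  then have "\<Omega> \<noteq> UNIV"
    using compact_imp_bounded not_bounded_UNIV by blast
  then have ne: "- \<Omega> \<noteq> {}"
    by auto
  have zero_iff: "\<rho> p = 0 \<longleftrightarrow> p \<notin> interior \<Omega>" for p
    unfolding \<rho>_def using in_closure_iff_infdist_zero[OF ne, of p] by (simp add: closure_complement)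
  have lip: "\<bar>\<rho> p - \<rho> q\<bar> \<le> dist p q" for p q
    unfolding \<rho>_def by (rule infdist_triangle_abs)
  have grad: "norm (partial_x \<rho> p, partial_y \<rho> p) \<le> 2" if "gradient_defined_at \<rho> p" for p
  proof -
    have "\<bar>partial_x \<rho> p\<bar> \<le> 1" "\<bar>partial_y \<rho> p\<bar> \<le> 1"
      unfolding partial_x_def partial_y_def using that
      by (intro abs_deriv_le_Lipschitz order_trans[OF lip];
          simp add: gradient_defined_at_def dist_Pair_Pair dist_real_def)+
    then show ?thesis
      using norm_Pair_le[of "partial_x \<rho> p" "partial_y \<rho> p"] by simp
  qed
  have "continuous_on \<Omega> \<rho>"
    unfolding \<rho>_def by (intro continuous_intros)
  moreover have "concave_on \<Omega> \<rho>"
    unfolding \<rho>_def using c(2) \<open>\<Omega> \<noteq> UNIV\<close> by (rule concave_on_infdist_compl)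
  moreover have "\<forall>p\<in>frontier \<Omega>. \<rho> p = 0"
    by (simp add: zero_iff frontier_def)
  moreover have "\<exists>p\<in>\<Omega>. \<rho> p \<noteq> 0"
    using c(3) interior_subset by (auto simp: zero_iff)
  ultimately have "\<rho> \<in> U_class_nonzero \<Omega>"
    using grad unfolding U_class_nonzero_def U_class_def by blast
  then show ?thesis
    by blast
qed

section \<open>The bound on the quotient\<close>

lemma projection_eq_interval:
  fixes f :: "real \<times> real \<Rightarrow> real"
  assumes \<Omega>: "convex_compact_domain \<Omega>" and f: "continuous_on UNIV f"
    and open_map: "\<And>S. open S \<Longrightarrow> open (f ` S)"
  obtains a b where "f ` \<Omega> = {a..b}" "a < b"
proof -
  have c: "compact \<Omega>" "convex \<Omega>" "interior \<Omega> \<noteq> {}"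
    using \<Omega> by (auto simp: convex_compact_domain_def)
  have f\<Omega>: "continuous_on \<Omega> f"
    using f by (rule continuous_on_subset) simp
  have "compact (f ` \<Omega>)" "connected (f ` \<Omega>)"
    using c f\<Omega> by (simp_all add: compact_continuous_image connected_continuous_image convex_connected)
  then obtain a b where ab: "f ` \<Omega> = {a..b}"
    using connected_compact_interval_1[of "f ` \<Omega>"] by auto
  moreover have "interior {a..b} \<noteq> {}"
    using interior_maximal[OF image_mono[OF interior_subset] open_map[OF open_interior], of \<Omega>] c(3)
    unfolding ab by blast
  ultimately show thesis
    using that by auto
qed

lemma K\<^sub>1_k\<^sub>1_bounds:
  assumes \<Omega>: "convex_compact_domain \<Omega>"
  shows "0 < k\<^sub>1 \<Omega> \<and> k\<^sub>1 \<Omega> \<le> K\<^sub>1 \<Omega> \<and> K\<^sub>1 \<Omega> < \<infinity> \<and> K\<^sub>1 \<Omega> / k\<^sub>1 \<Omega> \<le> 4"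
proof -
  obtain a b where ab: "fst ` \<Omega> = {a..b}" "a < b"
    by (rule projection_eq_interval[OF \<Omega> continuous_on_fst[OF continuous_on_id] open_image_fst])
  obtain c d where cd: "snd ` \<Omega> = {c..d}" "c < d"
    by (rule projection_eq_interval[OF \<Omega> continuous_on_snd[OF continuous_on_id] open_image_snd])
  define r where "r = (d - c) / (b - a)"
  have "0 < r"
    using ab cd by (simp add: r_def)
  have lo: "ennreal (r / 2) \<le> k\<^sub>1 \<Omega>"
    unfolding k\<^sub>1_def using U_class_ratio_bounds(1)[OF \<Omega> _ ab cd]
    by (intro INF_greatest) (simp add: r_def mult.commute)
  have hi: "K\<^sub>1 \<Omega> \<le> ennreal (2 * r)"
    unfolding K\<^sub>1_def using U_class_ratio_bounds(2)[OF \<Omega> _ ab cd]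
    by (intro SUP_least) (simp add: r_def)
  have le: "k\<^sub>1 \<Omega> \<le> K\<^sub>1 \<Omega>"
    unfolding k\<^sub>1_def K\<^sub>1_def by (rule INF_le_SUP[OF U_class_nonzero_nonempty[OF \<Omega>]])
  have "K\<^sub>1 \<Omega> \<noteq> top" "k\<^sub>1 \<Omega> \<noteq> top"
    using hi le by (auto simp: top_unique)
  then obtain K k where K: "K\<^sub>1 \<Omega> = ennreal K" "0 \<le> K" and k: "k\<^sub>1 \<Omega> = ennreal k" "0 \<le> k"
    by (metis ennreal_cases)
  have Kk: "K \<le> 2 * r" "r / 2 \<le> k"
    using lo hi K k \<open>0 < r\<close> by simp_all
  have "0 < k"
    using Kk \<open>0 < r\<close> by linarith
  have "K / k \<le> 4"
    using Kk \<open>0 < k\<close> by (simp add: divide_simps)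
  then have "ennreal (K / k) \<le> ennreal 4"
    by (rule ennreal_leI)
  then have "K\<^sub>1 \<Omega> / k\<^sub>1 \<Omega> \<le> 4"
    using K k \<open>0 < k\<close> by (simp add: divide_ennreal)
  moreover have "0 < k\<^sub>1 \<Omega>" "K\<^sub>1 \<Omega> < \<infinity>"
    unfolding K(1) k(1) using \<open>0 < k\<close> by simp_all
  ultimately show ?thesis
    using le by blast
qed

theorem mainTheorem2:
  shows "(\<forall>\<Omega>. convex_compact_domain \<Omega> \<longrightarrow>
            0 < k\<^sub>1 \<Omega> \<and> k\<^sub>1 \<Omega> \<le> K\<^sub>1 \<Omega> \<and> K\<^sub>1 \<Omega> < \<infinity> \<and> K\<^sub>1 \<Omega> / k\<^sub>1 \<Omega> \<le> 4)
       \<and> r\<^sub>1 \<le> 4"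
proof (rule conjI)
  show "\<forall>\<Omega>. convex_compact_domain \<Omega> \<longrightarrow>
      0 < k\<^sub>1 \<Omega> \<and> k\<^sub>1 \<Omega> \<le> K\<^sub>1 \<Omega> \<and> K\<^sub>1 \<Omega> < \<infinity> \<and> K\<^sub>1 \<Omega> / k\<^sub>1 \<Omega> \<le> 4"
    by (intro allI impI) (rule K\<^sub>1_k\<^sub>1_bounds)
  have disc: "convex_compact_domain (cball 0 1)"
    by (simp add: convex_compact_domain_def interior_cball)
  have "r\<^sub>1 \<le> K\<^sub>1 (cball 0 1) / k\<^sub>1 (cball 0 1)"
    unfolding r\<^sub>1_def using disc by (intro INF_lower) simp
  also have "\<dots> \<le> 4"
    using K\<^sub>1_k\<^sub>1_bounds[OF disc] by blast
  finally show "r\<^sub>1 \<le> 4" .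
qed

end
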